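(* Let $d$ and $m$ be integers with $1\le m\le d$, let $R>1$ be a real number, and write $R_1:=\frac{m}{d}(R+1)-1$. Let $p(x)=p_d\prod_{j=1}^d(x-z_j)$, $p_d\neq 0$, be a polynomial of degree $d$ with complex coefficients and roots $z_1,\dots,z_d\in\mathbb{C}$ such that $$|z_j|\le 1 \text{ for } j\le m,\qquad |z_j|\ge R \text{ for } j>m.$$ Then $m-1$ roots of the derivative $p'(x)$ lie in the closed unit disc $D(0,1)$, while its other $d-m$ roots lie outside the open disc $\{x\in\mathbb{C}:|x|<R_1\}$.
   Context: $D(0,1)=\{x\in\mathbb{C}:|x|\le 1\}$. Roots are counted with multiplicity; $p'$ has degree $d-1$ and hence $d-1=(m-1)+(d-m)$ roots.
   Formalization: The formal statement additionally assumes m = 1 or R_1 ≥ 1; without this the claim is false: p = (x−1/3)^3−1 with d = 3, m = 2, R = 4/3, R_1 = 5/9 has both roots of p' equal to 1/3, inside |x| < R_1. *)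

theory Defs
  imports "HOL-Analysis.Analysis" "HOL-Computational_Algebra.Computational_Algebra"
begin

text \<open>
  Let \<open>d = 3\<close>, \<open>m = 2\<close>, \<open>R = 4/3\<close>, so that \<open>R1 = m / d * (R + 1) - 1 = 5/9\<close>. The roots
  of \<open>(x - 1/3)^3 - 1\<close> are \<open>-1/6 \<plusminus> \<i> sqrt 3 / 2\<close>, which lie in the unit disc, and
  \<open>4/3\<close>, but both roots of the derivative are \<open>1/3\<close>, inside the open disc of radius \<open>5/9\<close>.
  This is why the localization of the roots of the derivative is stated for
  \<open>m = 1 \<or> 1 \<le> R1\<close> only.
\<close>

lemma critical_points_counterexample:
  fixes z :: "nat \<Rightarrow> complex" and p :: "complex poly"
  defines "z \<equiv> (\<lambda>j. if j = 1 then Complex (-1/6) (sqrt 3 / 2)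
                   else if j = 2 then Complex (-1/6) (- sqrt 3 / 2) else 4/3)"
  defines "p \<equiv> smult 1 (\<Prod>j = 1..3. [:- z j, 1:])"
  shows "\<forall>j\<in>{1..2}. cmod (z j) \<le> 1"
    and "\<forall>j\<in>{2<..3}. 4/3 \<le> cmod (z j)"
    and "\<not> (\<exists>A B. proots (pderiv p) = A + B \<and> size A = 2 - 1 \<and> size B = 3 - 2 \<and>
              (\<forall>w\<in>#A. w \<in> cball 0 1) \<and> (\<forall>w\<in>#B. w \<notin> ball 0 (2/3 * (4/3 + 1) - 1)))"
proof -
  have "cmod (Complex (-1/6) (sqrt 3 / 2)) \<le> 1" "cmod (Complex (-1/6) (- sqrt 3 / 2)) \<le> 1"
    by (simp_all add: cmod_def power_divide)
  then show "\<forall>j\<in>{1..2}. cmod (z j) \<le> 1"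
    by (simp add: z_def)
  show "\<forall>j\<in>{2<..3}. 4/3 \<le> cmod (z j)"
    by (auto simp: z_def)
  have "{1..3} = {1, 2, 3::nat}"
    by auto
  then have "p = [:- z 1, 1:] * [:- z 2, 1:] * [:- z 3, 1:]"
    by (simp add: p_def algebra_simps)
  also have "\<dots> = [:-28/27, 1/3, -1, 1:]"
    by (simp add: z_def complex_eq_iff algebra_simps)
  finally have deriv: "pderiv p = smult 3 ([:-1/3, 1:] ^ 2)"
    by (simp add: pderiv_pCons power2_eq_square)
  have "proots (smult 3 ([:-1/3, 1:] ^ 2)) = repeat_mset 2 (proots [:-1/3, 1 :: complex:])"
    using proots_smult proots_power by (metis zero_neq_numeral)
  then have roots: "proots (pderiv p) = {#1/3, 1/3#}"
    unfolding deriv by (simp add: numeral_2_eq_2)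
  show "\<not> (\<exists>A B. proots (pderiv p) = A + B \<and> size A = 2 - 1 \<and> size B = 3 - 2 \<and>
              (\<forall>w\<in>#A. w \<in> cball 0 1) \<and> (\<forall>w\<in>#B. w \<notin> ball 0 (2/3 * (4/3 + 1) - 1)))"
  proof (clarify)
    fix A B :: "complex multiset"
    assume eq: "proots (pderiv p) = A + B" and "size B = 3 - 2"
      and B: "\<forall>w\<in>#B. w \<notin> ball 0 (2/3 * (4/3 + 1) - 1)"
    then obtain w where "w \<in># B"
      by (cases B) auto
    moreover from this have "w \<in># {#1/3, 1/3#}"
      using eq roots by (metis union_iff)
    then have "cmod w = 1/3"
      by (auto simp del: eq_divide_eq_numeral1 simp: norm_divide)
    ultimately show False
      using B by force
  qed
qed

end

theory Submission
  imports Defs "HOL-Complex_Analysis.Complex_Analysis"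
begin

text \<open>
  Write \<open>p = q * r\<close>, where \<open>q\<close> has the roots in the closed unit disc and \<open>r\<close> the others, so that
  \<open>p' = q' * r + q * r'\<close>. On a circle of radius \<open>\<rho>\<close> with \<open>1 < \<rho> < R\<close> the logarithmic derivatives
  satisfy \<open>\<bar>q'/q\<bar> \<ge> m / (\<rho> + 1)\<close> and \<open>\<bar>r'/r\<bar> \<le> (d - m) / (R - \<rho>)\<close>, so by Rouche's theorem
  \<open>q' * r + t * q * r'\<close> has as many roots in the disc as \<open>q' * r\<close>, namely \<open>m - 1\<close>,
  whenever \<open>t (d - m) / (R - \<rho>) < m / (\<rho> + 1)\<close>. For \<open>t < 1\<close> this covers all \<open>\<rho>\<close> slightly beyond
  \<open>R1\<close>; letting \<open>t\<close> tend to \<open>1\<close> also gives the boundary case \<open>R1 = 1\<close>, where no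
  circle separates the two groups of roots of \<open>p'\<close>.
\<close>

section \<open>Counting roots of polynomials in a disc by Rouche's theorem\<close>

abbreviation roots_below :: "real \<Rightarrow> complex poly \<Rightarrow> complex multiset" where
  "roots_below \<rho> f \<equiv> {#w \<in># proots f. cmod w < \<rho>#}"

text \<open>Links the analytic multiplicity in Rouche's theorem to the algebraic one in
  \<open>proots\<close>: splitting off the full power of the linear factor leaves a cofactor that
  does not vanish at \<open>a\<close>, and this is the local form that determines
  \<open>zorder\<close>.\<close>

lemma zorder_poly:
  fixes f :: "complex poly"
  assumes "f \<noteq> 0"
  shows "zorder (poly f) a = int (order a f)"
proof -
  obtain g where g: "f = [:- a, 1:] ^ order a f * g" "\<not> [:- a, 1:] dvd g"
    using order_decomp[OF assms] by blast
  show ?thesis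
  proof (rule zorder_eqI[of UNIV _ "poly g"])
    show "poly g a \<noteq> 0"
      using g(2) by (simp add: poly_eq_0_iff_dvd)
    fix w
    have "poly f w = poly ([:- a, 1:] ^ order a f * g) w"
      using g(1) by simp
    then show "poly f w = poly g w * (w - a) powi int (order a f)"
      by (simp add: poly_power power_int_def mult.commute)
  qed (auto intro!: holomorphic_intros)
qed

lemma size_roots_below:
  assumes "f \<noteq> 0"
  shows "size (roots_below \<rho> f) = (\<Sum>a | poly f a = 0 \<and> cmod a < \<rho>. order a f)"
  using assms by (auto simp: size_multiset_overloaded_eq intro!: sum.cong)

text \<open>The winding number of the circle is 1 inside and 0 outside, and no root lies on the
  circle itself. So the weighted sum in Rouche's theorem is the number of roots inside, with
  multiplicity.\<close>

lemma sum_winding_number_zorder_poly: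
  assumes "f \<noteq> 0" and "0 < \<rho>" and "\<And>x. cmod x = \<rho> \<Longrightarrow> poly f x \<noteq> 0"
  shows "(\<Sum>a\<in>{a. poly f a = 0}. winding_number (circlepath 0 \<rho>) a * zorder (poly f) a)
           = of_nat (size (roots_below \<rho> f))"
proof -
  have "(\<Sum>a\<in>{a. poly f a = 0}. winding_number (circlepath 0 \<rho>) a * zorder (poly f) a)
          = (\<Sum>a | poly f a = 0 \<and> cmod a < \<rho>. of_nat (order a f))"
  proof (rule sum.mono_neutral_cong_right)
    show "finite {a. poly f a = 0}"
      using assms(1) by (rule poly_roots_finite)
    show "\<forall>a\<in>{a. poly f a = 0} - {a. poly f a = 0 \<and> cmod a < \<rho>}.
            winding_number (circlepath 0 \<rho>) a * zorder (poly f) a = 0"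
    proof
      fix a assume a: "a \<in> {a. poly f a = 0} - {a. poly f a = 0 \<and> cmod a < \<rho>}"
      with assms(3)[of a] have "\<rho> < cmod a"
        by fastforce
      then have "winding_number (circlepath 0 \<rho>) a = 0"
        using assms(2) by (intro winding_number_zero_outside[of _ "cball 0 \<rho>"]) auto
      then show "winding_number (circlepath 0 \<rho>) a * zorder (poly f) a = 0"
        by simp
    qed
    fix a assume "a \<in> {a. poly f a = 0 \<and> cmod a < \<rho>}"
    then show "winding_number (circlepath 0 \<rho>) a * zorder (poly f) a = of_nat (order a f)"
      using winding_number_circlepath[of a 0 \<rho>] zorder_poly[OF assms(1)] by simp
  qed auto
  then show ?thesis
    by (simp add: size_roots_below[OF assms(1)])
qed

lemma Rouche_poly:
  fixes f g :: "complex poly"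
  assumes "0 < \<rho>" and less: "\<And>x. cmod x = \<rho> \<Longrightarrow> cmod (poly g x) < cmod (poly f x)"
  shows "size (roots_below \<rho> (f + g)) = size (roots_below \<rho> f)"
proof -
  have f0: "poly f x \<noteq> 0" if "cmod x = \<rho>" for x
    using less[OF that] by auto
  have fg0: "poly (f + g) x \<noteq> 0" if "cmod x = \<rho>" for x
    using less[OF that] by (metis add_eq_0_iff2 norm_minus_cancel order_less_irrefl poly_add)
  \<comment> \<open>The point \<rho> of the circle witnesses that neither polynomial is zero, so
    both root sets are finite.\<close>
  have "cmod (of_real \<rho>) = \<rho>"
    using assms(1) by simp
  then have ne: "f \<noteq> 0" "f + g \<noteq> 0"
    using f0 fg0 by (metis poly_0)+
  have "(\<Sum>a\<in>{a \<in> UNIV. poly f a + poly g a = 0}.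
            winding_number (circlepath 0 \<rho>) a * zorder (\<lambda>a. poly f a + poly g a) a)
          = (\<Sum>a\<in>{a \<in> UNIV. poly f a = 0}. winding_number (circlepath 0 \<rho>) a * zorder (poly f) a)"
    using assms poly_roots_finite[OF ne(1)] poly_roots_finite[OF ne(2)]
    by (intro Rouche_theorem) (auto intro!: holomorphic_intros)
  moreover have "poly (f + g) = (\<lambda>a. poly f a + poly g a)"
    by auto
  ultimately have "(of_nat (size (roots_below \<rho> (f + g))) :: complex)
                     = of_nat (size (roots_below \<rho> f))"
    using sum_winding_number_zorder_poly[OF ne(1) assms(1) f0]
      sum_winding_number_zorder_poly[OF ne(2) assms(1) fg0] by simp
  then show ?thesis
    using of_nat_eq_iff by blast
qed

text \<open>By compactness |g/f| has a bound B on the circle, so for |s| < 1/B the term s g is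
  strictly smaller than f there and Rouche's theorem applies.\<close>

lemma size_roots_below_perturb:
  fixes f g :: "complex poly"
  assumes "0 < \<rho>" and "\<And>x. cmod x = \<rho> \<Longrightarrow> poly f x \<noteq> 0"
  shows "\<exists>e>0. \<forall>s. cmod s < e \<longrightarrow>
           size (roots_below \<rho> (f + smult s g)) = size (roots_below \<rho> f)"
proof -
  have "continuous_on (sphere 0 \<rho>) (\<lambda>x. cmod (poly g x) / cmod (poly f x))"
    using assms(2) by (auto intro!: continuous_intros)
  then have "compact ((\<lambda>x. cmod (poly g x) / cmod (poly f x)) ` sphere 0 \<rho>)"
    by (rule compact_continuous_image) simp
  then obtain B where B: "B > 0"
    "\<And>x. cmod x = \<rho> \<Longrightarrow> norm (cmod (poly g x) / cmod (poly f x)) \<le> B"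
    by (auto dest!: compact_imp_bounded simp: bounded_pos)
  have "size (roots_below \<rho> (f + smult s g)) = size (roots_below \<rho> f)" if s: "cmod s < 1 / B" for s
  proof (rule Rouche_poly[OF assms(1)])
    fix x assume x: "cmod x = \<rho>"
    have f: "cmod (poly f x) > 0"
      using assms(2)[OF x] by simp
    have "cmod (poly g x) \<le> B * cmod (poly f x)"
      using B(2)[OF x] f by (simp add: field_simps)
    then have "cmod s * cmod (poly g x) \<le> cmod s * (B * cmod (poly f x))"
      by (rule mult_left_mono) simp
    also have "\<dots> = (cmod s * B) * cmod (poly f x)"
      by simp
    also have "\<dots> < 1 * cmod (poly f x)"
      using s B(1) f by (intro mult_strict_right_mono) (auto simp: field_simps)
    finally show "cmod (poly (smult s g) x) < cmod (poly f x)"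
      by (simp add: norm_mult)
  qed
  then show ?thesis
    using B(1) by (intro exI[of _ "1 / B"]) auto
qed

section \<open>Bounds for logarithmic derivatives of products of linear factors\<close>

lemma poly_pderiv_prod_linear:
  fixes z :: "'b \<Rightarrow> 'a :: field_char_0"
  assumes "finite J" and "\<And>j. j \<in> J \<Longrightarrow> x \<noteq> z j"
  shows "poly (pderiv (\<Prod>j\<in>J. [:- z j, 1:])) x
           = poly (\<Prod>j\<in>J. [:- z j, 1:]) x * (\<Sum>j\<in>J. 1 / (x - z j))"
  using assms
proof (induction J rule: finite_induct)
  case (insert i J)
  then have "x - z i \<noteq> 0"
    by simp
  with insert show ?case
    by (simp add: pderiv_mult pderiv_pCons distrib_left poly_prod del: mult_pCons_left)
qed (simp add: pderiv_1)

text \<open>Since |x - z_j| \<ge> R - |x| > 0, each term 1 / (x - z_j) of the logarithmic derivative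
  has modulus at most 1 / (R - |x|). The bound is stated with denominators cleared, as Rouche's
  theorem compares values of polynomials.\<close>

lemma cmod_poly_pderiv_le:
  assumes "finite J" and "\<And>j. j \<in> J \<Longrightarrow> R \<le> cmod (z j)" and "cmod x < R"
  shows "cmod (poly (pderiv (\<Prod>j\<in>J. [:- z j, 1:])) x) * (R - cmod x)
           \<le> card J * cmod (poly (\<Prod>j\<in>J. [:- z j, 1:]) x)"
proof -
  have le: "R - cmod x \<le> cmod (x - z j)" if "j \<in> J" for j
    using assms(2)[OF that] norm_triangle_ineq3[of x "z j"] by linarith
  have "cmod (\<Sum>j\<in>J. 1 / (x - z j)) \<le> (\<Sum>j\<in>J. 1 / (R - cmod x))"
    using le assms(3) by (intro sum_norm_le) (auto simp: norm_divide intro!: divide_left_mono mult_pos_pos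
      intro: less_le_trans[of _ "R - cmod x"])
  then have "cmod (\<Sum>j\<in>J. 1 / (x - z j)) * (R - cmod x) \<le> card J"
    using assms(3) by (simp add: field_simps)
  then have "cmod (poly (\<Prod>j\<in>J. [:- z j, 1:]) x) * (cmod (\<Sum>j\<in>J. 1 / (x - z j)) * (R - cmod x))
     \<le> cmod (poly (\<Prod>j\<in>J. [:- z j, 1:]) x) * card J"
    by (rule mult_left_mono) simp
  moreover have "x \<noteq> z j" if "j \<in> J" for j
    using le[OF that] assms(3) by auto
  ultimately show ?thesis
    using assms(1) by (simp add: poly_pderiv_prod_linear norm_mult mult_ac)
qed

text \<open>The real part is (1 - Re t) / |1 - t|^2. After clearing denominators, the two sides
  differ by (1 - |t|) (|t| + Re t), which is nonnegative.\<close>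

lemma Re_inverse_ge:
  assumes "cmod t < 1"
  shows "1 / (1 + cmod t) \<le> Re (1 / (1 - t))"
proof -
  have "t \<noteq> 1"
    using assms by auto
  then have pos: "cmod (1 - t) ^ 2 > 0"
    by simp
  have "0 \<le> (1 - cmod t) * (cmod t + Re t)"
    using assms abs_Re_le_cmod[of t] by (intro mult_nonneg_nonneg) linarith+
  moreover have "cmod (1 - t) ^ 2 = 1 - 2 * Re t + cmod t ^ 2"
    unfolding cmod_power2 by (simp add: power2_eq_square algebra_simps)
  ultimately have "cmod (1 - t) ^ 2 \<le> (1 - Re t) * (1 + cmod t)"
    by (simp add: power2_eq_square algebra_simps)
  then have "1 / (1 + cmod t) \<le> (1 - Re t) / cmod (1 - t) ^ 2"
    using pos add_pos_nonneg[of 1 "cmod t"] by (simp add: field_simps)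
  also have "\<dots> = Re (1 / (1 - t))"
    by (simp add: Re_divide cmod_power2)
  finally show ?thesis .
qed

text \<open>Terms 1 / (x - z_j) could cancel, but after multiplication by x each becomes 1 / (1 -
  z_j / x) with |z_j / x| < 1, whose real part is at least |x| / (|x| + 1). Real parts add up, and
  the modulus of the sum dominates its real part.\<close>

lemma cmod_poly_pderiv_ge:
  assumes "finite J" and "\<And>j. j \<in> J \<Longrightarrow> cmod (z j) \<le> 1" and "1 < cmod x"
  shows "card J * cmod (poly (\<Prod>j\<in>J. [:- z j, 1:]) x)
           \<le> cmod (poly (pderiv (\<Prod>j\<in>J. [:- z j, 1:])) x) * (cmod x + 1)"
proof -
  have x0: "x \<noteq> 0"
    using assms(3) by auto
  have Re: "cmod x / (cmod x + 1) \<le> Re (x * (1 / (x - z j)))" if "j \<in> J" for j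
  proof -
    have t: "cmod (z j / x) \<le> 1 / cmod x"
      using assms(2)[OF that] by (simp add: norm_divide divide_right_mono)
    also have "1 / cmod x < 1"
      using assms(3) by (subst divide_less_eq_1) auto
    finally have lt: "cmod (z j / x) < 1" .
    have "cmod x / (cmod x + 1) = 1 / (1 + 1 / cmod x)"
      using x0 by (simp add: field_simps)
    also have "\<dots> \<le> 1 / (1 + cmod (z j / x))"
      using t by (intro divide_left_mono mult_pos_pos) (auto intro!: add_pos_nonneg)
    also have "\<dots> \<le> Re (1 / (1 - z j / x))"
      using lt by (rule Re_inverse_ge)
    also have "1 / (1 - z j / x) = x * (1 / (x - z j))"
      using x0 by (simp add: field_simps)
    finally show ?thesis .
  qed
  have "card J * (cmod x / (cmod x + 1)) \<le> (\<Sum>j\<in>J. Re (x * (1 / (x - z j))))"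
    using Re by (rule sum_bounded_below)
  also have "\<dots> = Re (x * (\<Sum>j\<in>J. 1 / (x - z j)))"
    by (simp add: sum_distrib_left)
  also have "\<dots> \<le> cmod x * cmod (\<Sum>j\<in>J. 1 / (x - z j))"
    using complex_Re_le_cmod[of "x * (\<Sum>j\<in>J. 1 / (x - z j))"] by (simp only: norm_mult)
  finally have "cmod x * (card J / (cmod x + 1)) \<le> cmod x * cmod (\<Sum>j\<in>J. 1 / (x - z j))"
    by (simp add: mult.commute)
  then have "card J / (cmod x + 1) \<le> cmod (\<Sum>j\<in>J. 1 / (x - z j))"
    using x0 by (subst (asm) mult_le_cancel_left_pos) auto
  then have "card J \<le> cmod (\<Sum>j\<in>J. 1 / (x - z j)) * (cmod x + 1)"
    by (subst (asm) pos_divide_le_eq) (auto intro: add_nonneg_pos)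
  then have "cmod (poly (\<Prod>j\<in>J. [:- z j, 1:]) x) * card J
     \<le> cmod (poly (\<Prod>j\<in>J. [:- z j, 1:]) x) * (cmod (\<Sum>j\<in>J. 1 / (x - z j)) * (cmod x + 1))"
    by (rule mult_left_mono) simp
  moreover have "x \<noteq> z j" if "j \<in> J" for j
    using assms(2)[OF that] assms(3) by auto
  ultimately show ?thesis
    using assms(1) by (simp add: poly_pderiv_prod_linear norm_mult mult_ac)
qed

section \<open>Root count of the interpolated derivative\<close>

lemma poly_prod_linear_eq_0_iff:
  fixes z :: "'b \<Rightarrow> 'a :: idom"
  assumes "finite J"
  shows "poly (\<Prod>j\<in>J. [:- z j, 1:]) x = 0 \<longleftrightarrow> x \<in> z ` J"
  using assms by (auto simp: poly_prod)

lemma prod_linear_neq_0: "(\<Prod>j\<in>J. [:- z j, 1 :: 'a :: idom:]) \<noteq> 0"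
  by (cases "finite J") auto

lemma degree_prod_linear: "degree (\<Prod>j\<in>J. [:- z j, 1 :: 'a :: idom:]) = card J"
  by (cases "finite J") (auto simp: degree_prod_sum_eq)

text \<open>The Gauss-Lucas theorem for the unit disc. Outside the disc the lower bound on the
  derivative would make a critical point a root of the product itself, but all those roots lie in
  the disc.\<close>

lemma pderiv_prod_linear_roots:
  assumes "finite J" and "J \<noteq> {}" and "\<And>j. j \<in> J \<Longrightarrow> cmod (z j) \<le> 1"
    and "poly (pderiv (\<Prod>j\<in>J. [:- z j, 1:])) x = 0"
  shows "cmod x \<le> 1"
proof (rule ccontr)
  assume x: "\<not> cmod x \<le> 1"
  have "card J * cmod (poly (\<Prod>j\<in>J. [:- z j, 1:]) x) \<le> 0"
    using cmod_poly_pderiv_ge[where z = z and x = x, OF assms(1,3)] x assms(4) by simp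
  then have "poly (\<Prod>j\<in>J. [:- z j, 1:]) x = 0"
    using assms(1,2) by (simp add: mult_le_0_iff)
  then show False
    using assms(1,3) x by (auto simp: poly_prod_linear_eq_0_iff)
qed

text \<open>At t = 1 the polynomial is the derivative of \<open>q * r\<close>. The inequality
  between t and \<rho> is strict because Rouche's theorem needs strict domination on the circle; at
  t = 1 and \<rho> = R1 it degenerates to an equality, which is why t < 1 is used later.\<close>

lemma size_roots_below_interpolation:
  fixes z :: "'b \<Rightarrow> complex" and \<rho> t :: real
  assumes "finite I" and "I \<noteq> {}" and "finite J"
    and zI: "\<And>i. i \<in> I \<Longrightarrow> cmod (z i) \<le> 1" and zJ: "\<And>j. j \<in> J \<Longrightarrow> R \<le> cmod (z j)"
    and "1 < \<rho>" and "\<rho> < R" and "0 \<le> t"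
    and t: "t * card J * (\<rho> + 1) < card I * (R - \<rho>)"
  defines "q \<equiv> \<Prod>i\<in>I. [:- z i, 1:]" and "r \<equiv> \<Prod>j\<in>J. [:- z j, 1:]"
  shows "size (roots_below \<rho> (pderiv q * r + smult t (q * pderiv r))) = card I - 1"
proof -
  have "size (roots_below \<rho> (pderiv q * r + smult t (q * pderiv r)))
          = size (roots_below \<rho> (pderiv q * r))"
  proof (rule Rouche_poly)
    fix x assume x: "cmod x = \<rho>"
    define Q where "Q = cmod (poly q x)"
    define S where "S = cmod (poly r x)"
    define Q' where "Q' = cmod (poly (pderiv q) x)"
    define S' where "S' = cmod (poly (pderiv r) x)"
    have Q: "card I * Q \<le> Q' * (\<rho> + 1)"
      using cmod_poly_pderiv_ge[where z = z and x = x, OF assms(1) zI] assms(6) x by (simp add: Q_def Q'_def q_def add.commute)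
    have S: "S' * (R - \<rho>) \<le> card J * S"
      using cmod_poly_pderiv_le[where z = z and x = x, OF assms(3) zJ] assms(7) x by (simp add: S_def S'_def r_def)
    have "poly q x \<noteq> 0" "poly r x \<noteq> 0"
      unfolding q_def r_def poly_prod_linear_eq_0_iff[OF assms(1)] poly_prod_linear_eq_0_iff[OF assms(3)]
      using zI zJ assms(6,7) x by fastforce+
    then have pos: "Q > 0" "S > 0"
      by (auto simp: Q_def S_def)
    \<comment> \<open>The positive factor (R - \<rho>) (\<rho> + 1) clears the denominators of both
      bounds and is cancelled at the end.\<close>
    have "t * Q * S' * ((R - \<rho>) * (\<rho> + 1)) = (S' * (R - \<rho>)) * (t * Q * (\<rho> + 1))"
      by (simp add: mult_ac)
    also have "\<dots> \<le> (card J * S) * (t * Q * (\<rho> + 1))"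
      using S pos assms(6,8) by (intro mult_right_mono) auto
    also have "\<dots> = (t * card J * (\<rho> + 1)) * (Q * S)"
      by (simp add: mult_ac)
    also have "\<dots> < (card I * (R - \<rho>)) * (Q * S)"
      using t pos by (intro mult_strict_right_mono) auto
    also have "\<dots> = (card I * Q) * ((R - \<rho>) * S)"
      by (simp add: mult_ac)
    also have "\<dots> \<le> (Q' * (\<rho> + 1)) * ((R - \<rho>) * S)"
      using Q pos assms(7) by (intro mult_right_mono) auto
    also have "\<dots> = Q' * S * ((R - \<rho>) * (\<rho> + 1))"
      by (simp add: mult_ac)
    finally have "t * Q * S' < Q' * S"
      using assms(6,7) by (simp add: mult_less_cancel_right_pos)
    then show "cmod (poly (smult t (q * pderiv r)) x) < cmod (poly (pderiv q * r) x)"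
      using assms(8) by (simp add: norm_mult Q_def S_def Q'_def S'_def mult_ac)
  qed (use assms(6) in simp)
  \<comment> \<open>By Gauss-Lucas all roots of \<open>pderiv q\<close> have modulus at most 1 <
    \<rho>, while those of \<open>r\<close> have modulus at least R > \<rho>. Hence exactly the
    roots of \<open>pderiv q\<close> are counted.\<close>
  also have "\<dots> = card I - 1"
  proof -
    have dq: "degree q = card I" and r0: "r \<noteq> 0"
      by (simp_all only: q_def r_def degree_prod_linear prod_linear_neq_0 not_False_eq_True)
    have "card I > 0"
      using assms(1,2) by (simp add: card_gt_0_iff)
    with dq have q'0: "pderiv q \<noteq> 0"
      by (simp add: pderiv_eq_0_iff)
    have "cmod w < \<rho>" if "w \<in># proots (pderiv q)" for w
      using pderiv_prod_linear_roots[where z = z and x = w, OF assms(1,2) zI] that q'0 assms(6)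
      by (auto simp: q_def)
    then have "roots_below \<rho> (pderiv q) = proots (pderiv q)"
      by (simp add: filter_mset_eq_conv)
    moreover have "\<not> cmod w < \<rho>" if "w \<in># proots r" for w
      using that zJ assms(3,7) r0 by (fastforce simp: r_def poly_prod_linear_eq_0_iff)
    then have "roots_below \<rho> r = {#}"
      by (intro multiset_eqI) (auto simp: not_in_iff[symmetric])
    ultimately have "roots_below \<rho> (pderiv q * r) = proots (pderiv q)"
      using q'0 r0 by (simp add: proots_mult)
    then show ?thesis
      by (simp add: size_proots_complex degree_pderiv dq)
  qed
  finally show ?thesis .
qed

section \<open>Critical points in the two discs\<close>

lemma eventually_at_left_norm_less:
  assumes "finite Z"
  shows "\<forall>\<^sub>F \<rho> in at_left r. \<forall>w\<in>Z. norm w < r \<longrightarrow> norm w < \<rho>"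
proof (rule eventually_ball_finite[OF assms], intro ballI)
  fix w assume "w \<in> Z"
  show "\<forall>\<^sub>F \<rho> in at_left r. norm w < r \<longrightarrow> norm w < \<rho>"
    by (cases "norm w < r") (auto intro: order_tendstoD(1)[OF tendsto_ident_at])
qed

lemma eventually_at_right_norm_le:
  assumes "finite Z"
  shows "\<forall>\<^sub>F \<rho> in at_right r. \<forall>w\<in>Z. r < norm w \<longrightarrow> \<rho> < norm w"
proof (rule eventually_ball_finite[OF assms], intro ballI)
  fix w assume "w \<in> Z"
  show "\<forall>\<^sub>F \<rho> in at_right r. r < norm w \<longrightarrow> \<rho> < norm w"
    by (cases "r < norm w") (auto intro: order_tendstoD(2)[OF tendsto_ident_at])
qed

lemma size_roots_below_mono: "a \<le> b \<Longrightarrow> size (roots_below a f) \<le> size (roots_below b f)"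
  by (intro size_mset_mono filter_mset_mono_strong) auto

text \<open>The interpolated polynomials are small perturbations of \<open>P\<close> as t tends to
  1, so their root counts carry over on circles free of roots of \<open>P\<close>. Roots may reach
  the boundary in the limit: this leaves an upper bound for the open disc of radius R1 and a lower
  bound for the closed unit disc.\<close>

lemma critical_points_count:
  fixes z :: "'b \<Rightarrow> complex" and R R1 :: real
  assumes "finite I" and "I \<noteq> {}" and "finite J" and "J \<noteq> {}"
    and zI: "\<And>i. i \<in> I \<Longrightarrow> cmod (z i) \<le> 1" and zJ: "\<And>j. j \<in> J \<Longrightarrow> R \<le> cmod (z j)"
    and R1: "1 \<le> R1" "(card I + card J) * (R1 + 1) = card I * (R + 1)"
    and P: "P = pderiv ((\<Prod>i\<in>I. [:- z i, 1:]) * (\<Prod>j\<in>J. [:- z j, 1:]))"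
  shows "size (roots_below R1 P) \<le> card I - 1"
    and "card I - 1 \<le> size {#w \<in># proots P. cmod w \<le> 1#}"
proof -
  define q where "q = (\<Prod>i\<in>I. [:- z i, 1:])"
  define r where "r = (\<Prod>j\<in>J. [:- z j, 1:])"
  define g where "g = q * pderiv r"
  have cI: "card I > 0" and cJ: "card J > 0"
    using assms(1-4) by (auto simp: card_gt_0_iff)
  have "degree (q * r) = card I + card J"
    unfolding q_def r_def by (subst degree_mult_eq) (auto simp: degree_prod_linear prod_linear_neq_0)
  then have P0: "P \<noteq> 0"
    using cI by (simp add: P flip: q_def r_def) (simp add: pderiv_eq_0_iff)
  have fin: "finite {w. poly P w = 0}"
    using P0 by (rule poly_roots_finite)
  have P_perturb: "P + smult (of_real (t - 1)) g = pderiv q * r + smult (of_real t) g" for t :: real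
    by (simp add: P g_def pderiv_mult smult_diff_left mult.commute flip: q_def r_def)
  \<comment> \<open>R1 is the radius at which the lower bound for q'/q and the upper bound for r'/r
    coincide.\<close>
  have "card J * (R1 + 1) = card I * (R - R1)"
    using R1(2) by (simp add: algebra_simps)
  moreover have "card J * (R1 + 1) > 0"
    using cJ R1(1) by simp
  ultimately have "R1 < R"
    using cI by (simp add: zero_less_mult_iff)
  \<comment> \<open>For t < 1 the balance at R1 becomes a strict inequality at every s up to R1, and
    by continuity it persists slightly to the right of s. Used below with s = R1 and with s =
    1.\<close>
  have near: "\<exists>t::real. cmod (of_real (t - 1)) < e \<and>
      (\<forall>\<^sub>F \<rho> in at_right s. size (roots_below \<rho> (P + smult (of_real (t - 1)) g)) = card I - 1)"
    if "e > 0" "1 \<le> s" "s \<le> R1" for e s :: real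
  proof -
    \<comment> \<open>The maximum with 0 keeps t nonnegative when e is large; in either case |t - 1|
      \<le> e / 2 < e.\<close>
    define t where "t = max 0 (1 - e / 2)"
    have t: "0 \<le> t" "t < 1" "cmod (of_real (t - 1)) < e"
      using that(1) unfolding norm_of_real by (auto simp: t_def)
    have "t * (card J * (s + 1)) < 1 * (card J * (s + 1))"
      using t cJ that(2) by (intro mult_strict_right_mono) auto
    also have "\<dots> \<le> card J * (R1 + 1)"
      using that(3) by (simp add: mult_left_mono)
    also have "\<dots> \<le> card I * (R - s)"
      using \<open>card J * (R1 + 1) = _\<close> that(3) by (simp add: mult_left_mono)
    finally have "0 < card I * (R - s) - t * card J * (s + 1)"
      by (simp add: mult.assoc)
    moreover have "((\<lambda>\<rho>. card I * (R - \<rho>) - t * card J * (\<rho> + 1))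
                      \<longlongrightarrow> card I * (R - s) - t * card J * (s + 1)) (at_right s)"
      by (intro tendsto_intros)
    ultimately have "\<forall>\<^sub>F \<rho> in at_right s. 0 < card I * (R - \<rho>) - t * card J * (\<rho> + 1)"
      by (rule order_tendstoD(1)[rotated])
    moreover have "\<forall>\<^sub>F \<rho> in at_right s. \<rho> < R"
      using \<open>R1 < R\<close> that(3) by (intro order_tendstoD(2)[OF tendsto_ident_at]) auto
    moreover have "\<forall>\<^sub>F \<rho> in at_right s. s < \<rho>"
      by (rule eventually_at_right_less)
    ultimately have "\<forall>\<^sub>F \<rho> in at_right s.
        size (roots_below \<rho> (P + smult (of_real (t - 1)) g)) = card I - 1"
    proof eventually_elim
      case (elim \<rho>)
      then show ?case
        unfolding P_perturb unfolding g_def q_def r_def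
        using assms(1-3) zI zJ that(2) t(1)
        by (intro size_roots_below_interpolation) auto
    qed
    with t(3) show ?thesis
      by blast
  qed
  show "size (roots_below R1 P) \<le> card I - 1"
  proof -
    \<comment> \<open>A radius so close to R1 that no root of \<open>P\<close> has modulus in
      [\<rho>, R1): the count below R1 is unchanged, and the circle of radius \<rho> carries no
      root, so the count is stable under perturbation.\<close>
    have "\<forall>\<^sub>F \<rho> in at_left R1. 0 < \<rho> \<and> \<rho> < R1 \<and> (\<forall>w\<in>{w. poly P w = 0}. cmod w < R1 \<longrightarrow> cmod w < \<rho>)"
      using R1(1) by (intro eventually_conj eventually_at_left_norm_less[OF fin]
        eventually_at_left_real order_tendstoD(1)[OF tendsto_ident_at]) (auto simp: eventually_at_filter)
    then obtain \<rho> where \<rho>: "0 < \<rho>" "\<rho> < R1" "\<And>w. poly P w = 0 \<Longrightarrow> cmod w < R1 \<Longrightarrow> cmod w < \<rho>"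
      using eventually_happens[of _ "at_left R1"] by (auto simp: trivial_limit_at_left_real)
    then have "poly P x \<noteq> 0" if "cmod x = \<rho>" for x
      using that by fastforce
    from size_roots_below_perturb[OF \<rho>(1) this, of g]
    obtain e where e: "e > 0"
      "\<And>s. cmod s < e \<Longrightarrow> size (roots_below \<rho> (P + smult s g)) = size (roots_below \<rho> P)"
      by blast
    obtain t :: real where t: "cmod (of_real (t - 1)) < e"
      "\<forall>\<^sub>F \<rho> in at_right R1. size (roots_below \<rho> (P + smult (of_real (t - 1)) g)) = card I - 1"
      using near[OF e(1) R1(1)] by blast
    \<comment> \<open>For the same t, the perturbed polynomial has exactly \<open>card I - 1\<close>
      roots below a radius beyond R1, so at most that many below \<rho>.\<close>
    obtain \<rho>2 where \<rho>2: "R1 < \<rho>2" "size (roots_below \<rho>2 (P + smult (of_real (t - 1)) g)) = card I - 1"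
      using eventually_happens[OF eventually_conj[OF eventually_at_right_less t(2)]]
      by (auto simp: trivial_limit_at_right_real)
    have "roots_below R1 P = roots_below \<rho> P"
      using \<rho> P0 by (intro filter_mset_cong) auto
    then have "size (roots_below R1 P) = size (roots_below \<rho> (P + smult (of_real (t - 1)) g))"
      using e(2) t(1) by metis
    also have "\<dots> \<le> size (roots_below \<rho>2 (P + smult (of_real (t - 1)) g))"
      using \<rho>(2) \<rho>2(1) by (intro size_roots_below_mono) auto
    finally show ?thesis
      using \<rho>2(2) by simp
  qed
  show "card I - 1 \<le> size {#w \<in># proots P. cmod w \<le> 1#}"
  proof -
    \<comment> \<open>Mirror image of the previous argument: no root of \<open>P\<close> has modulus
      in (1, \<rho>], and the perturbed roots are counted at a radius \<rho>2 below \<rho>, which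
      gives a lower bound.\<close>
    obtain \<rho> where \<rho>: "1 < \<rho>" "\<And>w. poly P w = 0 \<Longrightarrow> 1 < cmod w \<Longrightarrow> \<rho> < cmod w"
      using eventually_happens[OF eventually_conj[OF eventually_at_right_less
          eventually_at_right_norm_le[OF fin, of 1]]]
      by (auto simp: trivial_limit_at_right_real)
    then have "poly P x \<noteq> 0" if "cmod x = \<rho>" for x
      using that by fastforce
    from size_roots_below_perturb[where \<rho> = \<rho> and g = g, OF _ this] \<rho>(1)
    obtain e where e: "e > 0"
      "\<And>s. cmod s < e \<Longrightarrow> size (roots_below \<rho> (P + smult s g)) = size (roots_below \<rho> P)"
      by force
    obtain t :: real where t: "cmod (of_real (t - 1)) < e"
      "\<forall>\<^sub>F \<rho> in at_right 1. size (roots_below \<rho> (P + smult (of_real (t - 1)) g)) = card I - 1"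
      using near[OF e(1) order_refl R1(1)] by blast
    have "\<forall>\<^sub>F \<rho>2 in at_right 1. \<rho>2 < \<rho>"
      using \<rho>(1) by (intro order_tendstoD(2)[OF tendsto_ident_at]) auto
    then obtain \<rho>2 where \<rho>2: "\<rho>2 < \<rho>" "size (roots_below \<rho>2 (P + smult (of_real (t - 1)) g)) = card I - 1"
      using eventually_happens[OF eventually_conj[OF _ t(2)]]
      by (force simp: trivial_limit_at_right_real)
    have "card I - 1 \<le> size (roots_below \<rho> (P + smult (of_real (t - 1)) g))"
      using size_roots_below_mono[OF less_imp_le[OF \<rho>2(1)]] \<rho>2(2) by metis
    also have "\<dots> = size (roots_below \<rho> P)"
      using e(2) t(1) by blast
    also have "roots_below \<rho> P = {#w \<in># proots P. cmod w \<le> 1#}"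
      using \<rho> P0 by (intro filter_mset_cong) fastforce+
    finally show ?thesis .
  qed
qed

text \<open>With one root a in the unit disc, a direct estimate also covers R1 < 1. A critical point
  satisfies |x - a| |r'(x)| = |r(x)|; with |x - a| \<le> 1 + |x| and the upper bound for r'/r this
  forces R - |x| \<le> (1 + |x|) \<open>card J\<close>, contrary to |x| < R1.\<close>

lemma critical_points_single:
  fixes R R1 :: real
  assumes "finite J" and "cmod a \<le> 1" and zJ: "\<And>j. j \<in> J \<Longrightarrow> R \<le> cmod (z j)"
    and R1: "(1 + card J) * (R1 + 1) = R + 1" and "cmod x < R1"
  shows "poly (pderiv ([:- a, 1:] * (\<Prod>j\<in>J. [:- z j, 1:]))) x \<noteq> 0"
proof
  define r where "r = (\<Prod>j\<in>J. [:- z j, 1:])"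
  assume "poly (pderiv ([:- a, 1:] * (\<Prod>j\<in>J. [:- z j, 1:]))) x = 0"
  then have "(x - a) * poly (pderiv r) x + poly r x = 0"
    unfolding r_def[symmetric] pderiv_mult by (simp add: pderiv_pCons algebra_simps)
  then have eq: "cmod (x - a) * cmod (poly (pderiv r) x) = cmod (poly r x)"
    by (metis add_eq_0_iff norm_minus_cancel norm_mult)
  have J_lt: "(1 + cmod x) * card J < R - cmod x"
  proof -
    have "(1 + card J) * (cmod x + 1) < (1 + card J) * (R1 + 1)"
      using assms(5) by (intro mult_strict_left_mono) auto
    then show ?thesis
      using R1 by (simp add: algebra_simps)
  qed
  moreover have "0 \<le> (1 + cmod x) * card J"
    by (intro mult_nonneg_nonneg) auto
  ultimately have xR: "cmod x < R"
    by linarith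
  have r0: "poly r x \<noteq> 0"
    using zJ xR by (force simp: r_def poly_prod_linear_eq_0_iff[OF assms(1)])
  have "cmod (poly r x) * (R - cmod x)
          = cmod (x - a) * (cmod (poly (pderiv r) x) * (R - cmod x))"
    by (simp flip: eq add: mult.assoc)
  also have "\<dots> \<le> (1 + cmod x) * (card J * cmod (poly r x))"
    using cmod_poly_pderiv_le[where z = z, OF assms(1) zJ xR] norm_triangle_ineq4[of x a] assms(2) xR
    unfolding r_def by (intro mult_mono[of "cmod (x - a)"]) auto
  also have "\<dots> = cmod (poly r x) * ((1 + cmod x) * card J)"
    by (simp add: mult_ac)
  also have "\<dots> < cmod (poly r x) * (R - cmod x)"
    using J_lt r0 by (intro mult_strict_left_mono) auto
  finally show False
    by simp
qed

section \<open>Splitting the critical points into two groups\<close>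

lemma mset_subset_size_exists:
  assumes "n \<le> size M"
  shows "\<exists>N. N \<subseteq># M \<and> size N = n"
proof -
  obtain xs where xs: "mset xs = M"
    using ex_mset by blast
  have "mset xs = mset (take n xs) + mset (drop n xs)"
    by (metis append_take_drop_id mset_append)
  then have "mset (take n xs) \<subseteq># M"
    using xs by simp
  moreover have "size (mset (take n xs)) = n"
    using assms xs by auto
  ultimately show ?thesis
    by blast
qed

text \<open>\<open>A\<close> takes every element satisfying \<open>Q\<close> and is filled up to
  size \<open>n\<close> with further elements satisfying \<open>P\<close>. In the application
  \<open>P\<close> is |w| \<le> 1 and \<open>Q\<close> is |w| < R1, so elements on a shared boundary
  may go to either group.\<close>

lemma multiset_split_between:
  assumes "{#w \<in># M. Q w#} \<subseteq># {#w \<in># M. P w#}"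
    and "size {#w \<in># M. Q w#} \<le> n" and "n \<le> size {#w \<in># M. P w#}"
  shows "\<exists>A B. M = A + B \<and> size A = n \<and> (\<forall>w\<in>#A. P w) \<and> (\<forall>w\<in>#B. \<not> Q w)"
proof -
  obtain D where D: "{#w \<in># M. P w#} = {#w \<in># M. Q w#} + D"
    using assms(1) by (auto simp: subset_mset.le_iff_add)
  then have "n - size {#w \<in># M. Q w#} \<le> size D"
    using assms(3) by simp
  then obtain N where N: "N \<subseteq># D" "size N = n - size {#w \<in># M. Q w#}"
    using mset_subset_size_exists by blast
  define A where "A = {#w \<in># M. Q w#} + N"
  have A: "A \<subseteq># {#w \<in># M. P w#}"
    using N(1) by (simp add: A_def D)
  then have AM: "A \<subseteq># M"
    using multiset_filter_subset subset_mset.order_trans by blast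
  have "size A = n"
    using N(2) assms(2) by (simp add: A_def)
  moreover have "P w" if "w \<in># A" for w
    using mset_subset_eqD[OF A that] by simp
  moreover have "\<not> Q w" if "w \<in># M - A" for w
  proof
    assume "Q w"
    then have "count A w \<ge> count M w"
      by (simp add: A_def)
    then show False
      using that by (simp add: in_diff_count)
  qed
  moreover have "M = A + (M - A)"
    using AM by simp
  ultimately show ?thesis
    by blast
qed

theorem theorem2:
  fixes d m :: nat and R R1 :: real
    and p :: "complex poly" and pd :: complex and z :: "nat \<Rightarrow> complex"
  assumes "1 \<le> m" and "m \<le> d"
    and "R > 1"
    and "R1 = real m / real d * (R + 1) - 1"
    and "m = 1 \<or> 1 \<le> R1"
    and "pd \<noteq> 0"
    and "p = smult pd (\<Prod>j = 1..d. [:- z j, 1:])"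
    and "\<forall>j\<in>{1..m}. cmod (z j) \<le> 1"
    and "\<forall>j\<in>{m<..d}. R \<le> cmod (z j)"
  shows "\<exists>A B. proots (pderiv p) = A + B \<and> size A = m - 1 \<and> size B = d - m \<and>
           (\<forall>w\<in>#A. w \<in> cball 0 1) \<and> (\<forall>w\<in>#B. w \<notin> ball 0 R1)"
proof -
  define q where "q = (\<Prod>j\<in>{1..m}. [:- z j, 1:])"
  define r where "r = (\<Prod>j\<in>{m<..d}. [:- z j, 1:])"
  have "{1..d} = {1..m} \<union> {m<..d}"
    using assms(1,2) by auto
  then have prod: "(\<Prod>j = 1..d. [:- z j, 1:]) = q * r"
    unfolding q_def r_def by (simp only:) (rule prod.union_disjoint, auto)
  have roots: "proots (pderiv p) = proots (pderiv (q * r))"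
    unfolding assms(7) prod using assms(6) by (simp add: pderiv_smult)
  have deg: "degree (q * r) = d"
    unfolding prod[symmetric] by (simp only: degree_prod_linear card_atLeastAtMost diff_Suc_1)
  have size: "size (proots (pderiv (q * r))) = d - 1"
    by (simp add: size_proots_complex degree_pderiv deg)
  have P0: "pderiv (q * r) \<noteq> 0"
    using deg assms(1,2) by (simp add: pderiv_eq_0_iff)
  have R1: "real d * (R1 + 1) = real m * (R + 1)"
    using assms(1,2,4) by simp
  have zm: "cmod (z j) \<le> 1" if "j \<in> {1..m}" for j
    using assms(8) that by blast
  have zd: "R \<le> cmod (z j)" if "j \<in> {m<..d}" for j
    using assms(9) that by blast
  have "\<exists>A B. proots (pderiv (q * r)) = A + B \<and> size A = m - 1 \<and>
          (\<forall>w\<in>#A. cmod w \<le> 1) \<and> (\<forall>w\<in>#B. \<not> cmod w < R1)"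
  \<comment> \<open>For m = 1 the radius R1 may be below 1, so the direct estimate is used; for m =
    d there are no outer roots and Gauss-Lucas applies. Otherwise both groups are nonempty and 1
    \<le> R1.\<close>
  proof (cases "m = 1 \<or> m = d")
    case True
    then show ?thesis
    proof
      assume m: "m = 1"
      have "(1 + card {m<..d}) * (R1 + 1) = R + 1"
        using R1 m assms(2) by (simp add: of_nat_diff)
      then have "poly (pderiv (q * r)) w \<noteq> 0" if "cmod w < R1" for w
        using critical_points_single[of "{m<..d}" "z 1" R z R1 w] that zm zd m
        by (simp add: q_def r_def)
      then show ?thesis
        using m P0 by (intro exI[of _ "{#}"] exI[of _ "proots (pderiv (q * r))"]) auto
    next
      assume m: "m = d"
      then have "r = 1"
        by (simp add: r_def)
      then have "cmod w \<le> 1" if "poly (pderiv (q * r)) w = 0" for w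
        using pderiv_prod_linear_roots[of "{1..m}" z w] that zm assms(1) by (simp add: q_def)
      then show ?thesis
        using m P0 size by (intro exI[of _ "proots (pderiv (q * r))"] exI[of _ "{#}"]) auto
    qed
  next
    case False
    then have "1 \<le> R1"
      using assms(5) by simp
    have "size (roots_below R1 (pderiv (q * r))) \<le> card {1..m} - 1"
      and "card {1..m} - 1 \<le> size {#w \<in># proots (pderiv (q * r)). cmod w \<le> 1#}"
      using critical_points_count[of "{1..m}" "{m<..d}" z R R1] zm zd R1 \<open>1 \<le> R1\<close> assms(1,2) False
      by (simp_all add: q_def r_def of_nat_diff)
    then have le: "size (roots_below R1 (pderiv (q * r))) \<le> m - 1"
        "m - 1 \<le> size {#w \<in># proots (pderiv (q * r)). cmod w \<le> 1#}"
      by simp_all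
    \<comment> \<open>For R1 > 1 the discs are nested the other way. The two counts then squeeze
      both multisets to size m - 1, so they coincide and no critical point has modulus strictly
      between 1 and R1.\<close>
    have "roots_below R1 (pderiv (q * r)) \<subseteq># {#w \<in># proots (pderiv (q * r)). cmod w \<le> 1#}"
    proof (cases "R1 = 1")
      case True
      then show ?thesis
        by (intro filter_mset_mono_strong) auto
    next
      case False
      then have sub: "{#w \<in># proots (pderiv (q * r)). cmod w \<le> 1#} \<subseteq># roots_below R1 (pderiv (q * r))"
        using \<open>1 \<le> R1\<close> by (intro filter_mset_mono_strong) auto
      have "\<not> {#w \<in># proots (pderiv (q * r)). cmod w \<le> 1#} \<subset># roots_below R1 (pderiv (q * r))"
        using le by (auto dest!: mset_subset_size)
      with sub show ?thesis
        by (simp add: subset_mset.le_less)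
    qed
    then show ?thesis
      using le by (rule multiset_split_between)
  qed
  then obtain A B where AB: "proots (pderiv (q * r)) = A + B" "size A = m - 1"
      "\<forall>w\<in>#A. cmod w \<le> 1" "\<forall>w\<in>#B. \<not> cmod w < R1"
    by blast
  moreover have "size B = d - m"
    using size AB(1,2) assms(1) by simp
  ultimately show ?thesis
    unfolding roots by (intro exI[of _ A] exI[of _ B]) auto
qed

end
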